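(* Let $D$ be a DVD, let $M$ be a free $D$-module of finite rank $n \ge 2$, and set $R := \mathrm{End}(M)$. The following hold for a non-injective endomorphism $\alpha \in R$: (i) If $\mathrm{rk}(\ker(\alpha)) = 1$ and $\mathrm{Fix}(\alpha) = \{0_M\}$, then $\alpha = \beta\gamma$ for some non-identity $\beta, \gamma \in R^\#$ such that $\beta$ is a coprimitive idempotent of $R$ and $\mathrm{Fix}(\gamma) \neq \{0_M\}$. (ii) If $\alpha$ is a degree-$3$ $\mathrm{r.Fix}_R$-irreducible of $R^\#$, then $\alpha$ is a coprimitive idempotent of $R$.
   Context: A DVD (discrete valuation domain) is a commutative PID with a unique maximal ideal, generated by a non-zero prime element. $\mathrm{End}(M)$ is the ring of $D$-linear endomorphisms of $M$ under pointwise addition and composition. $\mathrm{rk}$ denotes the rank of a free $D$-module. For $f \in R$, $\mathrm{Fix}(f) := \{x \in M : f(x) = x\}$. $R^\#$ is the multiplicative submonoid of $R$ consisting of the identity $\mathrm{id}_M$ and of all elements that are both left and right zero divisors of $R$. For $a \in R$, $\mathrm{r.ann}(a) := \{x \in R : ax = 0\}$ and $\mathrm{r.Fix}(a) := \{x \in R : ax = x\}$. The $\mathrm{r.Fix}_R$-preorder on $R^\#$ is defined by $b \preceq c$ iff $\mathrm{r.Fix}(c) \subseteq \mathrm{r.Fix}(b)$; write $b \prec c$ if $b \preceq c$ and $c \not\preceq b$. The $\mathrm{r.Fix}_R$-non-units of $R^\#$ are the elements other than $\mathrm{id}_M$. A degree-$3$ $\mathrm{r.Fix}_R$-irreducible of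 $R^\#$ is an $\mathrm{r.Fix}_R$-non-unit $a \in R^\#$ such that for $k \in \{2, 3\}$ there are no $\mathrm{r.Fix}_R$-non-units $b_1, \ldots, b_k \in R^\#$ with $b_i \prec a$ for all $i$ and $a = b_1 \cdots b_k$. An idempotent $e \in R$ is coprimitive if $\mathrm{r.ann}(e)$ is an indecomposable submodule of $R_R$ (non-zero and not the direct sum of two non-zero submodules). *)

theory Defs
  imports Complex_Main "HOL-Computational_Algebra.Factorial_Ring"
begin

definition (in comm_ring_1) ring_ideal :: "'a set \<Rightarrow> bool" where
  "ring_ideal I \<longleftrightarrow> 0 \<in> I \<and> (\<forall>x\<in>I. \<forall>y\<in>I. x + y \<in> I) \<and> (\<forall>r. \<forall>x\<in>I. r * x \<in> I)"

definition (in comm_ring_1) maximal_ring_ideal :: "'a set \<Rightarrow> bool" where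
  "maximal_ring_ideal P \<longleftrightarrow>
     ring_ideal P \<and> P \<noteq> UNIV \<and> (\<forall>I. ring_ideal I \<and> P \<subseteq> I \<longrightarrow> I = P \<or> I = UNIV)"

class discrete_valuation_domain = idom +
  assumes ideals_principal: "ring_ideal I \<Longrightarrow> \<exists>a. I = range ((*) a)"
    and unique_maximal_ideal: "\<exists>!P. maximal_ring_ideal P"
    and maximal_ideal_prime_generated:
      "maximal_ring_ideal P \<Longrightarrow> \<exists>p. p \<noteq> 0 \<and> prime_elem p \<and> P = range ((*) p)"

context module
begin

definition free_of_rank :: "'b set \<Rightarrow> nat \<Rightarrow> bool" where
  "free_of_rank N k \<longleftrightarrow> (\<exists>B. finite B \<and> card B = k \<and> independent B \<and> span B = N)"

definition End :: "('b \<Rightarrow> 'b) set" where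
  "End = {f. module_hom scale scale f}"

end

definition Fix :: "('m \<Rightarrow> 'm) \<Rightarrow> 'm set" where
  "Fix f = {x. f x = x}"

text \<open>
  In the following, \<open>R\<close> is (the carrier of) a ring of additive maps \<open>'m \<Rightarrow> 'm\<close>; its addition is
  pointwise, its multiplication is composition, its zero is \<open>\<lambda>_. 0\<close> and its one is \<open>id\<close>.
\<close>

definition left_zero_divisor :: "('m::ab_group_add \<Rightarrow> 'm) set \<Rightarrow> ('m \<Rightarrow> 'm) \<Rightarrow> bool" where
  "left_zero_divisor R a \<longleftrightarrow> a \<in> R \<and> (\<exists>b\<in>R. b \<noteq> (\<lambda>_. 0) \<and> a \<circ> b = (\<lambda>_. 0))"

definition right_zero_divisor :: "('m::ab_group_add \<Rightarrow> 'm) set \<Rightarrow> ('m \<Rightarrow> 'm) \<Rightarrow> bool" where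
  "right_zero_divisor R a \<longleftrightarrow> a \<in> R \<and> (\<exists>b\<in>R. b \<noteq> (\<lambda>_. 0) \<and> b \<circ> a = (\<lambda>_. 0))"

definition sharp :: "('m::ab_group_add \<Rightarrow> 'm) set \<Rightarrow> ('m \<Rightarrow> 'm) set" where
  "sharp R = insert id {a \<in> R. left_zero_divisor R a \<and> right_zero_divisor R a}"

definition r_ann :: "('m::ab_group_add \<Rightarrow> 'm) set \<Rightarrow> ('m \<Rightarrow> 'm) \<Rightarrow> ('m \<Rightarrow> 'm) set" where
  "r_ann R a = {x \<in> R. a \<circ> x = (\<lambda>_. 0)}"

definition r_Fix :: "('m \<Rightarrow> 'm) set \<Rightarrow> ('m \<Rightarrow> 'm) \<Rightarrow> ('m \<Rightarrow> 'm) set" where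
  "r_Fix R a = {x \<in> R. a \<circ> x = x}"

definition r_Fix_le :: "('m \<Rightarrow> 'm) set \<Rightarrow> ('m \<Rightarrow> 'm) \<Rightarrow> ('m \<Rightarrow> 'm) \<Rightarrow> bool" where
  "r_Fix_le R b c \<longleftrightarrow> r_Fix R c \<subseteq> r_Fix R b"

definition r_Fix_less :: "('m \<Rightarrow> 'm) set \<Rightarrow> ('m \<Rightarrow> 'm) \<Rightarrow> ('m \<Rightarrow> 'm) \<Rightarrow> bool" where
  "r_Fix_less R b c \<longleftrightarrow> r_Fix_le R b c \<and> \<not> r_Fix_le R c b"

definition r_Fix_non_units :: "('m::ab_group_add \<Rightarrow> 'm) set \<Rightarrow> ('m \<Rightarrow> 'm) set" where
  "r_Fix_non_units R = sharp R - {id}"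

definition r_Fix_irreducible3 :: "('m::ab_group_add \<Rightarrow> 'm) set \<Rightarrow> ('m \<Rightarrow> 'm) \<Rightarrow> bool" where
  "r_Fix_irreducible3 R a \<longleftrightarrow>
     a \<in> r_Fix_non_units R \<and>
     (\<forall>k\<in>{2, 3}. \<not> (\<exists>bs. length bs = k \<and> set bs \<subseteq> r_Fix_non_units R \<and>
        (\<forall>b\<in>set bs. r_Fix_less R b a) \<and> a = foldr (\<circ>) bs id))"

definition right_submodule :: "('m::ab_group_add \<Rightarrow> 'm) set \<Rightarrow> ('m \<Rightarrow> 'm) set \<Rightarrow> bool" where
  "right_submodule R N \<longleftrightarrow>
     N \<subseteq> R \<and> (\<lambda>_. 0) \<in> N \<and>
     (\<forall>f\<in>N. \<forall>g\<in>N. (\<lambda>x. f x - g x) \<in> N) \<and>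
     (\<forall>f\<in>N. \<forall>r\<in>R. f \<circ> r \<in> N)"

definition indecomposable_submodule :: "('m::ab_group_add \<Rightarrow> 'm) set \<Rightarrow> ('m \<Rightarrow> 'm) set \<Rightarrow> bool" where
  "indecomposable_submodule R N \<longleftrightarrow>
     right_submodule R N \<and> N \<noteq> {\<lambda>_. 0} \<and>
     \<not> (\<exists>A B. right_submodule R A \<and> right_submodule R B \<and>
          A \<noteq> {\<lambda>_. 0} \<and> B \<noteq> {\<lambda>_. 0} \<and> A \<inter> B = {\<lambda>_. 0} \<and>
          N = {\<lambda>x. f x + g x |f g. f \<in> A \<and> g \<in> B})"

definition coprimitive_idempotent :: "('m::ab_group_add \<Rightarrow> 'm) set \<Rightarrow> ('m \<Rightarrow> 'm) \<Rightarrow> bool" where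
  "coprimitive_idempotent R e \<longleftrightarrow>
     e \<in> R \<and> e \<circ> e = e \<and> indecomposable_submodule R (r_ann R e)"

end

theory Submission
  imports Defs
begin

text \<open>
  Let \<open>\<alpha> k = 0\<close> with \<open>k \<noteq> 0\<close>. Counting equations and unknowns gives a nonzero functional \<open>\<phi>\<close> with
  \<open>\<phi> \<circ> \<alpha> = 0\<close>. Suppose that some nonzero functional \<open>\<psi>\<close> kills both \<open>k\<close> and \<open>Fix \<alpha>\<close>. As \<open>D\<close> is
  principal, both functionals may be taken surjective, and as \<open>D\<close> is local, they may then be
  rescaled so that \<open>\<phi> x = \<psi> x = 1\<close> for a common \<open>x\<close>. With \<open>v = x - \<alpha> x\<close> one has \<open>\<phi> v = 1\<close>, so
  \<open>\<beta> = id - \<phi>(\<cdot>) v\<close> is an idempotent with kernel \<open>D v\<close>, and \<open>\<gamma> = \<alpha> + \<psi>(\<cdot>) v\<close> satisfies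
  \<open>\<beta> \<circ> \<gamma> = \<alpha>\<close>, \<open>\<gamma> k = 0\<close> and \<open>\<gamma> x = x\<close>; both factors fix strictly more than \<open>\<alpha>\<close>. This settles the
  case \<open>Fix \<alpha> = {0}\<close>, where \<open>\<psi>\<close> exists by \<open>n \<ge> 2\<close>, and shows that a degree-3 irreducible \<open>\<alpha>\<close> admits
  no such \<open>\<psi>\<close>. Then \<open>M / (Fix \<alpha> + D k)\<close> is torsion, hence \<open>\<alpha>\<close> is idempotent with kernel of rank 1.
\<close>

section \<open>Homogeneous linear systems over a domain\<close>

text \<open>Induction on the equations. If all coefficients of equation \<open>i0\<close> on
  \<open>J\<close> vanish, it is vacuous; otherwise it is spent on eliminating one unknown, so both
  counts drop by one and the strict inequality survives. The rank arguments below go back to this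
  count, without passing to a fraction field.\<close>

lemma underdetermined_system_nontrivial_solution:
  fixes a :: "'i \<Rightarrow> 'j \<Rightarrow> 'd::idom"
  assumes "finite I" "finite J" "card I < card J"
  shows "\<exists>x. (\<exists>j\<in>J. x j \<noteq> 0) \<and> (\<forall>i\<in>I. (\<Sum>j\<in>J. a i j * x j) = 0)"
  using assms
proof (induction I arbitrary: J a rule: finite_induct)
  case empty
  then obtain j where "j \<in> J"
    by (metis card.empty card_gt_0_iff ex_in_conv)
  then show ?case
    by (intro exI[of _ "\<lambda>_. 1"]) auto
next
  case (insert i0 I)
  show ?case
  proof (cases "\<forall>j\<in>J. a i0 j = 0")
    case True
    have "card I < card J"
      using insert by simp
    then obtain x where "\<exists>j\<in>J. x j \<noteq> 0" "\<forall>i\<in>I. (\<Sum>j\<in>J. a i j * x j) = 0"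
      using insert.IH[of J a] insert.prems by blast
    then show ?thesis
      using True by (intro exI[of _ x]) auto
  next
    case False
    then obtain j0 where j0: "j0 \<in> J" "a i0 j0 \<noteq> 0"
      by blast
    define J' where "J' = J - {j0}"
    define p where "p = a i0 j0"
    define a' where "a' i j = p * a i j - a i j0 * a i0 j" for i j
    have J: "J = insert j0 J'" "j0 \<notin> J'" "finite J'"
      using j0 insert.prems by (auto simp: J'_def)
    have "card I < card J'"
      using insert J by simp
    then obtain x where x: "\<exists>j\<in>J'. x j \<noteq> 0" "\<forall>i\<in>I. (\<Sum>j\<in>J'. a' i j * x j) = 0"
      using insert.IH[of J' a'] J by blast
    \<comment> \<open>Fraction-free elimination: the unknown \<open>j0\<close> is solved from equation \<open>i0\<close> after multiplying
      all others by the pivot.\<close>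
    define y where "y j = (if j = j0 then - (\<Sum>j\<in>J'. a i0 j * x j) else p * x j)" for j
    have sum_y: "(\<Sum>j\<in>J. a i j * y j) = (\<Sum>j\<in>J'. a' i j * x j)" for i
    proof -
      have "(\<Sum>j\<in>J'. a i j * y j) = (\<Sum>j\<in>J'. a i j * (p * x j))"
        using J by (intro sum.cong) (auto simp: y_def)
      then have "(\<Sum>j\<in>J. a i j * y j)
          = (\<Sum>j\<in>J'. a i j * (p * x j)) - a i j0 * (\<Sum>j\<in>J'. a i0 j * x j)"
        using J by (simp add: y_def)
      also have "\<dots> = (\<Sum>j\<in>J'. a' i j * x j)"
        by (simp add: a'_def sum_distrib_left sum_subtractf algebra_simps)
      finally show ?thesis .
    qed
    \<comment> \<open>The elimination formula turns row \<open>i0\<close> itself into zero.\<close>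
    have "(\<Sum>j\<in>J. a i0 j * y j) = 0"
      unfolding sum_y by (simp add: a'_def p_def)
    moreover have "\<exists>j\<in>J. y j \<noteq> 0"
      using x(1) J j0 by (auto simp: y_def p_def)
    ultimately show ?thesis
      using x(2) sum_y by (intro exI[of _ y]) auto
  qed
qed

section \<open>Nonunits and the maximal ideal\<close>

text \<open>Zorn's lemma on the ideals that contain \<open>u\<close> but not \<open>1\<close>, a
  family that contains the principal ideal of \<open>u\<close>. A maximal member is a maximal ideal,
  because an ideal containing \<open>1\<close> is everything.\<close>

lemma nonunit_in_maximal_ring_ideal:
  fixes u :: "'d::comm_ring_1"
  assumes "\<not> u dvd 1"
  shows "\<exists>P. maximal_ring_ideal P \<and> u \<in> P"
proof -
  define \<I> where "\<I> = {I::'d set. ring_ideal I \<and> 1 \<notin> I \<and> u \<in> I}"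
  have "range ((*) u) \<in> \<I>"
  proof -
    have "range ((*) u) = {x. u dvd x}"
      by (auto simp: dvd_def)
    then show ?thesis
      using assms by (simp add: \<I>_def ring_ideal_def)
  qed
  moreover have "\<Union>\<C> \<in> \<I>" if "\<C> \<noteq> {}" "subset.chain \<I> \<C>" for \<C>
  proof -
    have ideals: "\<And>I. I \<in> \<C> \<Longrightarrow> ring_ideal I \<and> 1 \<notin> I \<and> u \<in> I"
      and chain: "\<And>I J. I \<in> \<C> \<Longrightarrow> J \<in> \<C> \<Longrightarrow> I \<subseteq> J \<or> J \<subseteq> I"
      using that(2) by (auto simp: subset_chain_def \<I>_def)
    have "x + y \<in> \<Union>\<C>" if xy: "x \<in> \<Union>\<C>" "y \<in> \<Union>\<C>" for x y
    proof -
      obtain I J where IJ: "I \<in> \<C>" "J \<in> \<C>" "x \<in> I" "y \<in> J"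
        using xy by blast
      then obtain K where "K \<in> \<C>" "x \<in> K" "y \<in> K"
        using chain[OF IJ(1,2)] by blast
      then show ?thesis
        using ideals[of K] by (auto simp: ring_ideal_def)
    qed
    moreover have "r * x \<in> \<Union>\<C>" if "x \<in> \<Union>\<C>" for r x
      using that ideals by (auto simp: ring_ideal_def)
    moreover have "0 \<in> \<Union>\<C>"
      using \<open>\<C> \<noteq> {}\<close> ideals by (auto simp: ring_ideal_def)
    ultimately have "ring_ideal (\<Union>\<C>)"
      by (simp add: ring_ideal_def)
    then show ?thesis
      using \<open>\<C> \<noteq> {}\<close> ideals by (auto simp: \<I>_def)
  qed
  ultimately obtain P where P: "P \<in> \<I>" "\<forall>X\<in>\<I>. P \<subseteq> X \<longrightarrow> X = P"
    using subset_Zorn_nonempty[of \<I>] by blast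
  have "I = P \<or> I = UNIV" if I: "ring_ideal I" "P \<subseteq> I" for I
  proof (cases "1 \<in> I")
    case True
    then have "x \<in> I" for x
      using I(1) by (metis mult.right_neutral ring_ideal_def)
    then show ?thesis
      by blast
  next
    case False
    then show ?thesis
      using P I by (auto simp: \<I>_def)
  qed
  then have "maximal_ring_ideal P"
    using P(1) by (auto simp: maximal_ring_ideal_def \<I>_def)
  then show ?thesis
    using P(1) by (auto simp: \<I>_def)
qed

text \<open>If \<open>u\<close> and \<open>1 + u\<close> were both nonunits, both would lie in the
  unique maximal ideal, and so would their difference \<open>1\<close>.\<close>

lemma nonunit_imp_one_plus_unit:
  fixes u :: "'d::discrete_valuation_domain"
  assumes "\<not> u dvd 1"
  shows "(1 + u) dvd 1"
proof (rule ccontr)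
  assume "\<not> (1 + u) dvd 1"
  then obtain P Q where "maximal_ring_ideal P" "u \<in> P" "maximal_ring_ideal Q" "1 + u \<in> Q"
    using nonunit_in_maximal_ring_ideal assms by metis
  then have P: "maximal_ring_ideal P" "u \<in> P" "1 + u \<in> P"
    using unique_maximal_ideal by blast+
  then have id: "ring_ideal P" and "P \<noteq> UNIV"
    by (auto simp: maximal_ring_ideal_def)
  have "(- 1) * u \<in> P"
    using id P(2) by (simp only: ring_ideal_def)
  then have "(1 + u) + (- 1) * u \<in> P"
    using id P(3) by (simp only: ring_ideal_def)
  then have "1 \<in> P"
    by simp
  then have "x \<in> P" for x
    using id by (metis mult.right_neutral ring_ideal_def)
  then show False
    using \<open>P \<noteq> UNIV\<close> by blast
qed

section \<open>Functionals, rank and torsion in a finite free module\<close>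

locale finite_free_module = module scale
  for scale :: "'d::idom \<Rightarrow> 'm::ab_group_add \<Rightarrow> 'm" (infixr "*s" 75) +
  fixes B :: "'m set"
  assumes finite_B: "finite B" and independent_B: "independent B" and span_B: "span B = UNIV"
begin

abbreviation coord :: "'m \<Rightarrow> 'm \<Rightarrow> 'd" where
  "coord \<equiv> representation B"

abbreviation functional :: "('m \<Rightarrow> 'd) \<Rightarrow> bool" where
  "functional \<theta> \<equiv> module_hom scale (*) \<theta>"

lemma functional_iff:
  "functional \<theta> \<longleftrightarrow> (\<forall>x y. \<theta> (x + y) = \<theta> x + \<theta> y) \<and> (\<forall>c x. \<theta> (c *s x) = c * \<theta> x)"
proof -
  have "module ((*) :: 'd \<Rightarrow> 'd \<Rightarrow> 'd)"
    by unfold_locales (auto simp: algebra_simps)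
  then show ?thesis
    using module_axioms by (simp add: module_hom_iff)
qed

lemma End_iff:
  "f \<in> End \<longleftrightarrow> (\<forall>x y. f (x + y) = f x + f y) \<and> (\<forall>c x. f (c *s x) = c *s f x)"
  using module_axioms by (simp add: End_def module_hom_iff)

lemma functional_coord_sum: "functional (\<lambda>x. \<Sum>b\<in>B. coord x b * a b)"
  unfolding functional_iff using independent_B span_B
  by (simp add: representation_add representation_scale sum.distrib sum_distrib_left algebra_simps)

lemma coord_sum_basis:
  assumes "b \<in> B"
  shows "(\<Sum>c\<in>B. coord b c * a c) = a b"
proof -
  have "(\<Sum>c\<in>B. coord b c * a c) = (\<Sum>c\<in>B. if c = b then a c else 0)"
    by (intro sum.cong) (auto simp: representation_basis[OF independent_B assms])
  then show ?thesis
    using assms finite_B by simp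
qed

lemma sum_coord: "(\<Sum>b\<in>B. coord x b *s b) = x"
  using sum_representation_eq[OF independent_B _ finite_B] span_B by simp

lemma eq_zero_iff_coord: "x = 0 \<longleftrightarrow> (\<forall>b\<in>B. coord x b = 0)"
proof
  assume "\<forall>b\<in>B. coord x b = 0"
  then have "(\<Sum>b\<in>B. coord x b *s b) = 0"
    by simp
  then show "x = 0"
    by (simp add: sum_coord)
qed (simp add: representation_zero)

lemma torsion_free: "c *s x = 0 \<longleftrightarrow> c = 0 \<or> x = 0"
proof
  assume "c *s x = 0"
  then have "\<forall>b\<in>B. c * coord x b = 0"
    using representation_scale[OF independent_B, of x c] span_B
    by (metis UNIV_I representation_zero)
  then show "c = 0 \<or> x = 0"
    using eq_zero_iff_coord by auto
qed auto

text \<open>The unknowns are the values of \<theta> on \<open>B\<close>, and each \<open>t\<close>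
  imposes one linear equation on them.\<close>

lemma exists_functional_killing:
  assumes "finite T" "card T < card B"
  shows "\<exists>\<theta> y. functional \<theta> \<and> \<theta> y \<noteq> 0 \<and> (\<forall>t\<in>T. \<theta> t = 0)"
proof -
  obtain a b where a: "b \<in> B" "a b \<noteq> 0" "\<forall>t\<in>T. (\<Sum>b\<in>B. coord t b * a b) = 0"
    using underdetermined_system_nontrivial_solution[OF assms(1) finite_B assms(2)] by blast
  then show ?thesis
    using functional_coord_sum[of a] coord_sum_basis[OF a(1), of a]
    by (intro exI[of _ "\<lambda>x. \<Sum>b\<in>B. coord x b * a b"] exI[of _ b]) simp
qed

text \<open>The unknowns are the coefficients of a relation on \<open>T\<close>; each basis vector
  contributes the equation that the corresponding coordinate vanish.\<close>

lemma dependent_if_card_greater: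
  assumes "finite T" "card T > card B"
  shows "dependent T"
proof -
  obtain u where u: "\<exists>t\<in>T. u t \<noteq> 0" "\<forall>b\<in>B. (\<Sum>t\<in>T. coord t b * u t) = 0"
    using underdetermined_system_nontrivial_solution[OF finite_B assms] by metis
  have "coord (\<Sum>t\<in>T. u t *s t) b = (\<Sum>t\<in>T. coord t b * u t)" for b
    using independent_B span_B
    by (simp add: representation_sum representation_scale mult.commute)
  then have "(\<Sum>t\<in>T. u t *s t) = 0"
    using u(2) eq_zero_iff_coord by simp
  then show ?thesis
    using u(1) assms(1) by (auto simp: dependent_finite)
qed

lemma independent_finite_card_le:
  assumes "independent T"
  shows "finite T \<and> card T \<le> card B"
proof -
  have le: "card T' \<le> card B" if "finite T'" "T' \<subseteq> T" for T'
    using that assms dependent_if_card_greater dependent_mono by (meson not_le)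
  moreover have "finite T"
    using le by (metis finite_if_finite_subsets_card_bdd)
  ultimately show ?thesis
    by blast
qed

text \<open>In a nontrivial relation on \<open>insert x T\<close> the coefficient of
  \<open>x\<close> is nonzero, since otherwise the relation would live on the independent set
  \<open>T\<close>. It serves as \<open>c\<close>.\<close>

lemma multiple_in_span_if_dependent_insert:
  assumes "independent T" "dependent (insert x T)"
  shows "\<exists>c. c \<noteq> 0 \<and> c *s x \<in> span T"
proof -
  have fin: "finite T" and x: "x \<notin> T"
    using independent_finite_card_le assms by (auto simp: insert_absorb)
  obtain u where u: "\<exists>v\<in>insert x T. u v \<noteq> 0" "(\<Sum>v\<in>insert x T. u v *s v) = 0"
    using assms(2) fin by (auto simp: dependent_finite)
  have eq: "u x *s x + (\<Sum>v\<in>T. u v *s v) = 0"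
    using u(2) fin x by simp
  have "u x \<noteq> 0"
  proof
    assume "u x = 0"
    then have "(\<Sum>v\<in>T. u v *s v) = 0" "\<exists>v\<in>T. u v \<noteq> 0"
      using eq u(1) by auto
    then show False
      using assms(1) fin by (auto simp: dependent_finite)
  qed
  have "u x *s x = - (\<Sum>v\<in>T. u v *s v)"
    using eq by (simp add: eq_neg_iff_add_eq_0)
  moreover have "- (\<Sum>v\<in>T. u v *s v) \<in> span T"
    by (intro span_neg span_sum span_scale span_base)
  ultimately have "u x *s x \<in> span T"
    by simp
  then show ?thesis
    using \<open>u x \<noteq> 0\<close> by blast
qed

text \<open>Take an independent \<open>T\<close> inside \<open>S\<close> of maximal size, so that
  every element of \<open>S\<close> has a nonzero multiple in \<open>span T\<close>. If
  \<open>T\<close> had fewer elements than \<open>B\<close>, some nonzero functional would kill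
  \<open>T\<close>, hence also \<open>S\<close>, because its values lie in a domain. So
  \<open>T\<close> is as large as \<open>B\<close>, and adjoining any further \<open>x\<close>
  creates a relation.\<close>

lemma torsion_quotient_if_no_functional:
  assumes "\<And>\<theta> y. functional \<theta> \<Longrightarrow> (\<forall>s\<in>S. \<theta> s = 0) \<Longrightarrow> \<theta> y = 0"
  shows "\<exists>c. c \<noteq> 0 \<and> c *s x \<in> span S"
proof -
  define Q where "Q T \<longleftrightarrow> T \<subseteq> S \<and> independent T" for T
  have "Q {}"
    by (simp add: Q_def independent_empty)
  moreover have "\<forall>T. Q T \<longrightarrow> card T < Suc (card B)"
    using independent_finite_card_le by (auto simp: Q_def less_Suc_eq_le)
  ultimately obtain T where T: "Q T" "\<And>T'. Q T' \<Longrightarrow> card T' \<le> card T"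
    using ex_has_greatest_nat[of Q "{}" card] by blast
  have TS: "T \<subseteq> S" and ind: "independent T" and fin: "finite T" and le: "card T \<le> card B"
    using T(1) independent_finite_card_le by (auto simp: Q_def)
  have S: "\<exists>c. c \<noteq> 0 \<and> c *s s \<in> span T" if "s \<in> S" for s
  proof (cases "s \<in> T")
    case True
    then show ?thesis
      using span_base by (intro exI[of _ 1]) auto
  next
    case False
    then have "dependent (insert s T)"
      using T(2)[of "insert s T"] fin TS that by (auto simp: Q_def)
    then show ?thesis
      using multiple_in_span_if_dependent_insert ind by blast
  qed
  have "card T = card B"
  proof (rule ccontr)
    assume "card T \<noteq> card B"
    then obtain \<theta> y where \<theta>: "functional \<theta>" "\<theta> y \<noteq> 0" "\<forall>t\<in>T. \<theta> t = 0"
      using exists_functional_killing[of T] fin le by auto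
    have span0: "\<theta> z = 0" if "z \<in> span T" for z
      using module_hom.eq_0_on_span[OF \<theta>(1), of T z] \<theta>(3) that by blast
    have "\<theta> s = 0" if s: "s \<in> S" for s
    proof -
      obtain c where "c \<noteq> 0" "c *s s \<in> span T"
        using S[OF s] by blast
      then have "c * \<theta> s = 0"
        using span0[of "c *s s"] \<theta>(1) by (simp add: functional_iff)
      then show ?thesis
        using \<open>c \<noteq> 0\<close> by simp
    qed
    then show False
      using assms[of \<theta> y] \<theta>(1,2) by blast
  qed
  have "\<exists>c. c \<noteq> 0 \<and> c *s x \<in> span T"
  proof (cases "x \<in> T")
    case True
    then show ?thesis
      using span_base by (intro exI[of _ 1]) auto
  next
    case False
    then have "dependent (insert x T)"
      using dependent_if_card_greater[of "insert x T"] fin \<open>card T = card B\<close> by simp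
    then show ?thesis
      using multiple_in_span_if_dependent_insert ind by blast
  qed
  then show ?thesis
    using span_mono[OF TS] by blast
qed

text \<open>Killing the images of all basis vectors except \<open>b0\<close> imposes fewer than
  \<open>card B\<close> conditions on \<theta>. Choosing \<open>b0\<close> with
  \<open>coord k b0\<close> nonzero lets \<open>f k = 0\<close> force the one remaining value to
  vanish.\<close>

lemma exists_functional_killing_range:
  assumes f: "f \<in> End" and k: "f k = 0" "k \<noteq> 0"
  shows "\<exists>\<theta> y. functional \<theta> \<and> \<theta> y \<noteq> 0 \<and> (\<forall>x. \<theta> (f x) = 0)"
proof -
  obtain b0 where b0: "b0 \<in> B" "coord k b0 \<noteq> 0"
    using k(2) eq_zero_iff_coord by blast
  have "card (f ` (B - {b0})) < card B"
    using finite_B b0(1) by (meson card_Diff1_less card_image_le finite_Diff le_less_trans)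
  then obtain \<theta> y where \<theta>: "functional \<theta>" "\<theta> y \<noteq> 0" "\<forall>b\<in>B - {b0}. \<theta> (f b) = 0"
    using exists_functional_killing[of "f ` (B - {b0})"] finite_B by auto
  have "module_hom scale scale f"
    using f by (simp add: End_def)
  then have comp: "functional (\<theta> \<circ> f)"
    using \<theta>(1) module_hom_compose by blast
  have expand: "\<theta> (f x) = coord x b0 * \<theta> (f b0)" for x
  proof -
    have "(\<theta> \<circ> f) x = (\<theta> \<circ> f) (\<Sum>b\<in>B. coord x b *s b)"
      by (simp only: sum_coord)
    also have "\<dots> = (\<Sum>b\<in>B. (\<theta> \<circ> f) (coord x b *s b))"
      using module_hom.sum[OF comp] by blast
    also have "\<dots> = (\<Sum>b\<in>B. coord x b * \<theta> (f b))"
      using comp by (simp add: functional_iff)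
    also have "\<dots> = coord x b0 * \<theta> (f b0)"
      using \<theta>(3) by (simp add: sum.remove[OF finite_B b0(1)])
    finally show ?thesis
      by simp
  qed
  have "\<theta> 0 = 0"
    using module_hom.zero[OF \<theta>(1)] .
  then have "\<theta> (f b0) = 0"
    using expand[of k] k(1) b0(2) by simp
  then show ?thesis
    using \<theta>(1,2) expand by (metis mult_zero_right)
qed

lemma exists_functional_nonzero:
  assumes "x \<noteq> 0"
  shows "\<exists>\<theta>. functional \<theta> \<and> \<theta> x \<noteq> 0"
proof -
  obtain b where "b \<in> B" "coord x b \<noteq> 0"
    using assms eq_zero_iff_coord by blast
  moreover have "functional (\<lambda>x. coord x b)"
    using independent_B span_B by (simp add: functional_iff representation_add representation_scale)
  ultimately show ?thesis
    by blast
qed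

section \<open>Rank-one maps, zero divisors and coprimitive idempotents\<close>

lemma rank_one_End: "functional \<theta> \<Longrightarrow> (\<lambda>x. \<theta> x *s v) \<in> End"
  by (simp add: functional_iff End_iff scale_left_distrib)

lemma End_zero: "f \<in> End \<Longrightarrow> f 0 = 0"
  by (simp add: End_def module_hom.zero)

lemma End_diff: "f \<in> End \<Longrightarrow> f (x - y) = f x - f y"
  by (simp add: End_def module_hom.diff)

text \<open>One rank-one map witnesses both conditions: its values are multiples of
  \<open>k\<close>, which \<open>f\<close> kills, and its functional vanishes on the range of
  \<open>f\<close>.\<close>

lemma singular_in_sharp:
  assumes f: "f \<in> End" and k: "f k = 0" "k \<noteq> 0"
  shows "f \<in> sharp End"
proof -
  obtain \<theta> y where \<theta>: "functional \<theta>" "\<theta> y \<noteq> 0" "\<And>x. \<theta> (f x) = 0"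
    using exists_functional_killing_range[OF assms] by blast
  define g where "g = (\<lambda>x. \<theta> x *s k)"
  have "g \<in> End"
    using rank_one_End[OF \<theta>(1)] by (simp add: g_def)
  moreover have "g y \<noteq> 0"
    using \<theta>(2) k(2) by (simp add: g_def torsion_free)
  then have "g \<noteq> (\<lambda>_. 0)"
    by auto
  moreover have "f \<circ> g = (\<lambda>_. 0)" "g \<circ> f = (\<lambda>_. 0)"
    using f k(1) \<theta>(3) by (auto simp: g_def End_iff)
  ultimately show ?thesis
    using f unfolding sharp_def left_zero_divisor_def right_zero_divisor_def by blast
qed

text \<open>The hypothesis \<open>rank1\<close> expresses that the kernel has rank one without
  choosing a basis of it. This torsion form is what the two applications below can supply
  directly.\<close>

lemma coprimitive_idempotentI:
  assumes e: "e \<in> End" "e \<circ> e = e" and k: "e k = 0" "k \<noteq> 0"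
    and rank1: "\<And>x. e x = 0 \<Longrightarrow> \<exists>c d. c \<noteq> 0 \<and> c *s x = d *s k"
  shows "coprimitive_idempotent End e"
proof -
  obtain \<theta> where \<theta>: "functional \<theta>" "\<theta> k \<noteq> 0"
    using exists_functional_nonzero[OF k(2)] by blast
  have sub: "right_submodule End (r_ann End e)"
    using e(1) unfolding right_submodule_def r_ann_def
    by (auto simp: fun_eq_iff End_iff End_zero End_diff scale_right_diff_distrib)
  have nonzero: "r_ann End e \<noteq> {\<lambda>_. 0}"
  proof -
    have "(\<lambda>x. \<theta> x *s k) \<in> r_ann End e"
      using rank_one_End[OF \<theta>(1)] e(1) k(1) by (auto simp: r_ann_def fun_eq_iff End_iff)
    moreover have "(\<lambda>x. \<theta> x *s k) \<noteq> (\<lambda>_. 0)"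
      using \<theta>(2) k(2) torsion_free by metis
    ultimately show ?thesis
      by blast
  qed
  \<comment> \<open>Nonzero right submodules of the annihilator meet, since any two of their values have a
    common nonzero multiple.\<close>
  have meet: False
    if A: "right_submodule End A" "A \<noteq> {\<lambda>_. 0}" "A \<subseteq> r_ann End e"
      and C: "right_submodule End C" "C \<noteq> {\<lambda>_. 0}" "C \<subseteq> r_ann End e"
      and AC: "A \<inter> C = {\<lambda>_. 0}" for A C
  proof -
    \<comment> \<open>All multiples of \<open>d\<close> are kept, so that the maps found in two
      submodules can be matched at a common multiple.\<close>
    have ex: "\<exists>d. d \<noteq> 0 \<and> (\<forall>c. (\<lambda>x. \<theta> x *s ((c * d) *s k)) \<in> X)"
      if X: "right_submodule End X" "X \<noteq> {\<lambda>_. 0}" "X \<subseteq> r_ann End e" for X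
    proof -
      obtain f where f: "f \<in> X" "f \<noteq> (\<lambda>_. 0)"
        using X(1,2) by (auto simp: right_submodule_def)
      then obtain m where m: "f m \<noteq> 0"
        by blast
      have fEnd: "f \<in> End" "e (f m) = 0"
        using f X(3) by (auto simp: r_ann_def fun_eq_iff)
      obtain c d where cd: "c \<noteq> 0" "c *s f m = d *s k"
        using rank1 fEnd(2) by blast
      have "d \<noteq> 0"
        using cd m torsion_free by force
      have in_X: "(\<lambda>x. \<theta> x *s ((a * d) *s k)) \<in> X" for a
      proof -
        \<comment> \<open>Precomposing \<open>f\<close> with a map into the multiples of
          \<open>c *s m\<close> gives values that are multiples of
          \<open>c *s f m = d *s k\<close>.\<close>
        have "f \<circ> (\<lambda>x. \<theta> x *s ((a * c) *s m)) \<in> X"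
          using X(1) f(1) rank_one_End[OF \<theta>(1)] unfolding right_submodule_def by blast
        moreover have "f \<circ> (\<lambda>x. \<theta> x *s ((a * c) *s m)) = (\<lambda>x. \<theta> x *s (a *s (c *s f m)))"
          using fEnd(1) by (auto simp: End_iff fun_eq_iff mult.assoc)
        ultimately show ?thesis
          using cd(2) by (simp add: mult.assoc)
      qed
      show "\<exists>d. d \<noteq> 0 \<and> (\<forall>c. (\<lambda>x. \<theta> x *s ((c * d) *s k)) \<in> X)"
        using \<open>d \<noteq> 0\<close> in_X by blast
    qed
    obtain d1 d2 where d: "d1 \<noteq> 0" "\<And>c. (\<lambda>x. \<theta> x *s ((c * d1) *s k)) \<in> A"
      "d2 \<noteq> 0" "\<And>c. (\<lambda>x. \<theta> x *s ((c * d2) *s k)) \<in> C"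
      using ex[OF A] ex[OF C] by blast
    have "(\<lambda>x. \<theta> x *s ((d2 * d1) *s k)) \<in> A \<inter> C"
      using d(2)[of d2] d(4)[of d1] by (simp add: mult.commute)
    then have "\<theta> k *s ((d2 * d1) *s k) = 0"
      using AC by (auto simp: fun_eq_iff)
    then show False
      using d \<theta>(2) k(2) by (auto simp: torsion_free simp del: scale_scale)
  qed
  have summands: "A \<subseteq> {\<lambda>x. f x + g x |f g. f \<in> A \<and> g \<in> C} \<and>
      C \<subseteq> {\<lambda>x. f x + g x |f g. f \<in> A \<and> g \<in> C}"
    if "right_submodule End A" "right_submodule End C" for A C
  proof -
    have zero: "(\<lambda>_. 0) \<in> A" "(\<lambda>_. 0) \<in> C"
      using that by (auto simp: right_submodule_def)
    have "\<exists>g h. f = (\<lambda>x. g x + h x) \<and> g \<in> A \<and> h \<in> C" if "f \<in> A \<or> f \<in> C" for f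
      using that
    proof
      assume "f \<in> A"
      then show ?thesis
        using zero(2) by (intro exI[of _ f] exI[of _ "\<lambda>_. 0"]) simp
    next
      assume "f \<in> C"
      then show ?thesis
        using zero(1) by (intro exI[of _ "\<lambda>_. 0"] exI[of _ f]) simp
    qed
    then show ?thesis
      by blast
  qed
  have "indecomposable_submodule End (r_ann End e)"
    unfolding indecomposable_submodule_def
  proof (intro conjI notI; (elim exE conjE)?)
    fix A C
    assume A: "right_submodule End A" "A \<noteq> {\<lambda>_. 0}" and C: "right_submodule End C" "C \<noteq> {\<lambda>_. 0}"
      and AC: "A \<inter> C = {\<lambda>_. 0}" and sum: "r_ann End e = {\<lambda>x. f x + g x |f g. f \<in> A \<and> g \<in> C}"
    have "A \<subseteq> r_ann End e" "C \<subseteq> r_ann End e"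
      using summands[OF A(1) C(1)] unfolding sum by blast+
    then show False
      using meet A C AC by blast
  qed (use sub nonzero in blast)+
  then show ?thesis
    using e by (simp add: coprimitive_idempotent_def)
qed

text \<open>A fixed vector \<open>x\<close> of \<open>g\<close> gives the map
  \<open>\<lambda>y. \<theta> y *s x\<close> in \<open>r_Fix End g\<close>; if \<theta> is nonzero
  at \<open>x\<close>, cancelling \<open>\<theta> x\<close> recovers \<open>f x = x\<close>.
  Conversely, all values of a map in \<open>r_Fix End g\<close> lie in \<open>Fix g\<close>.\<close>

lemma r_Fix_le_iff:
  assumes "f \<in> End" "g \<in> End"
  shows "r_Fix_le End f g \<longleftrightarrow> Fix g \<subseteq> Fix f"
proof
  assume le: "r_Fix_le End f g"
  show "Fix g \<subseteq> Fix f"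
  proof
    fix x assume x: "x \<in> Fix g"
    show "x \<in> Fix f"
    proof (cases "x = 0")
      case True
      then show ?thesis
        using assms(1) End_zero by (simp add: Fix_def)
    next
      case False
      obtain \<theta> where \<theta>: "functional \<theta>" "\<theta> x \<noteq> 0"
        using exists_functional_nonzero[OF False] by blast
      have "(\<lambda>y. \<theta> y *s x) \<in> r_Fix End g"
        using rank_one_End[OF \<theta>(1)] assms(2) x
        by (auto simp: r_Fix_def Fix_def fun_eq_iff End_iff)
      then have "f \<circ> (\<lambda>y. \<theta> y *s x) = (\<lambda>y. \<theta> y *s x)"
        using le by (auto simp: r_Fix_le_def r_Fix_def)
      then have "\<theta> x *s f x = \<theta> x *s x"
        using assms(1) by (simp add: End_iff fun_eq_iff)
      then have "\<theta> x *s (f x - x) = 0"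
        by (simp add: scale_right_diff_distrib)
      then show ?thesis
        using \<theta>(2) by (simp add: torsion_free Fix_def)
    qed
  qed
next
  assume "Fix g \<subseteq> Fix f"
  then show "r_Fix_le End f g"
    by (auto simp: r_Fix_le_def r_Fix_def Fix_def fun_eq_iff subset_iff)
qed

end

section \<open>Factoring singular endomorphisms over a discrete valuation domain\<close>

locale finite_free_dvd_module = finite_free_module scale B
  for scale :: "'d::discrete_valuation_domain \<Rightarrow> 'm::ab_group_add \<Rightarrow> 'm" (infixr "*s" 75)
    and B :: "'m set"
begin

text \<open>The values of \<theta> form an ideal, which is principal; dividing by its nonzero
  generator \<open>c\<close> leaves a functional that attains \<open>1\<close>.\<close>

lemma functional_primitive_part:
  assumes \<theta>: "functional \<theta>" "\<theta> y \<noteq> 0"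
  shows "\<exists>\<theta>' c z. functional \<theta>' \<and> \<theta>' z = 1 \<and> c \<noteq> 0 \<and> (\<forall>x. \<theta> x = c * \<theta>' x)"
proof -
  have "ring_ideal (range \<theta>)"
  proof -
    have "\<theta> x + \<theta> y = \<theta> (x + y)" "a * \<theta> x = \<theta> (a *s x)" "0 = \<theta> 0" for x y a
      using \<theta>(1) module_hom.zero[OF \<theta>(1)] by (simp_all add: functional_iff)
    then show ?thesis
      unfolding ring_ideal_def by auto
  qed
  then obtain c where c: "range \<theta> = range ((*) c)"
    using ideals_principal by blast
  have "c \<noteq> 0"
    using c \<theta>(2) by (metis imageE mult_zero_left rangeI)
  have "\<exists>t. \<theta> x = c * t" for x
    using c by (metis imageE rangeI)
  then obtain \<theta>' where \<theta>': "\<And>x. \<theta> x = c * \<theta>' x"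
    by metis
  obtain z where "\<theta> z = c"
    using c by (metis imageE mult.right_neutral rangeI)
  then have "\<theta>' z = 1"
    using \<theta>'[of z] \<open>c \<noteq> 0\<close> by simp
  moreover have "functional \<theta>'"
  proof -
    have "c * \<theta>' (x + y) = c * (\<theta>' x + \<theta>' y)" "c * \<theta>' (a *s x) = c * (a * \<theta>' x)" for x y a
      using \<theta>(1) by (simp_all add: functional_iff distrib_left mult.left_commute flip: \<theta>')
    then show ?thesis
      using \<open>c \<noteq> 0\<close> by (simp add: functional_iff)
  qed
  ultimately show ?thesis
    using \<theta>' \<open>c \<noteq> 0\<close> by blast
qed

text \<open>If \<open>a\<close> and \<open>b\<close> both fail, then \<open>\<psi> a\<close> and
  \<open>\<phi> b\<close> are nonunits, and \<open>a + b\<close> works: its values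
  \<open>1 + \<phi> b\<close> and \<open>\<psi> a + 1\<close> are units by locality.\<close>

lemma common_unit_vector:
  assumes "functional \<phi>" "\<phi> a = 1" "functional \<psi>" "\<psi> b = 1"
  shows "\<exists>x. \<phi> x dvd 1 \<and> \<psi> x dvd 1"
proof (cases "\<psi> a dvd 1 \<or> \<phi> b dvd 1")
  case True
  then show ?thesis
    using assms by (metis dvd_refl)
next
  case False
  then have "\<phi> (a + b) dvd 1" "\<psi> (a + b) dvd 1"
    using assms nonunit_imp_one_plus_unit[of "\<phi> b"] nonunit_imp_one_plus_unit[of "\<psi> a"]
    by (auto simp: functional_iff add.commute)
  then show ?thesis
    by blast
qed

text \<open>Serves both claims of the theorem: \<open>Fix \<alpha> \<subset> Fix \<gamma>\<close>
  makes \<open>Fix \<gamma>\<close> nonzero in the first, and the two strict inclusions contradict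
  irreducibility in the second.\<close>

lemma singular_factorization:
  assumes \<alpha>: "\<alpha> \<in> End" and k: "\<alpha> k = 0" "k \<noteq> 0"
    and \<psi>0: "functional \<psi>0" "\<psi>0 y \<noteq> 0" "\<psi>0 k = 0" "\<And>x. x \<in> Fix \<alpha> \<Longrightarrow> \<psi>0 x = 0"
  shows "\<exists>\<beta> \<gamma>. \<beta> \<in> sharp End \<and> \<beta> \<noteq> id \<and> \<gamma> \<in> sharp End \<and> \<gamma> \<noteq> id \<and> \<alpha> = \<beta> \<circ> \<gamma> \<and>
    \<beta> \<in> End \<and> \<gamma> \<in> End \<and> coprimitive_idempotent End \<beta> \<and> Fix \<alpha> \<subset> Fix \<beta> \<and> Fix \<alpha> \<subset> Fix \<gamma>"
proof -
  obtain \<phi>0 y0 where "functional \<phi>0" "\<phi>0 y0 \<noteq> 0" and \<phi>0: "\<And>x. \<phi>0 (\<alpha> x) = 0"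
    using exists_functional_killing_range[OF \<alpha> k] by blast
  then obtain \<phi>1 c a where \<phi>1: "functional \<phi>1" "\<phi>1 a = 1" "c \<noteq> 0" "\<And>x. \<phi>0 x = c * \<phi>1 x"
    using functional_primitive_part by metis
  obtain \<psi>1 d b where \<psi>1: "functional \<psi>1" "\<psi>1 b = 1" "d \<noteq> 0" "\<And>x. \<psi>0 x = d * \<psi>1 x"
    using functional_primitive_part[OF \<psi>0(1,2)] by metis
  obtain x where x: "\<phi>1 x dvd 1" "\<psi>1 x dvd 1"
    using common_unit_vector \<phi>1(1,2) \<psi>1(1,2) by blast
  then obtain r s where rs: "1 = \<phi>1 x * r" "1 = \<psi>1 x * s"
    by (auto elim!: dvdE)
  \<comment> \<open>Scaling by the inverses \<open>r\<close> and \<open>s\<close> normalises both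
    values at \<open>x\<close> to \<open>1\<close> and keeps every vanishing condition.\<close>
  define \<phi> where "\<phi> = (\<lambda>z. r * \<phi>1 z)"
  define \<psi> where "\<psi> = (\<lambda>z. s * \<psi>1 z)"
  have \<phi>: "functional \<phi>" "\<phi> x = 1" "\<And>z. \<phi> (\<alpha> z) = 0"
    using \<phi>1 \<phi>0 rs by (auto simp: \<phi>_def functional_iff algebra_simps)
  have \<psi>: "functional \<psi>" "\<psi> x = 1" "\<psi> k = 0" "\<And>z. z \<in> Fix \<alpha> \<Longrightarrow> \<psi> z = 0"
    using \<psi>1 \<psi>0 rs by (auto simp: \<psi>_def functional_iff algebra_simps)
  have \<phi>_diff: "\<phi> (z - w) = \<phi> z - \<phi> w" for z w
    using module_hom.diff[OF \<phi>(1)] .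
  define v where "v = x - \<alpha> x"
  define \<beta> where "\<beta> = (\<lambda>z. z - \<phi> z *s v)"
  define \<gamma> where "\<gamma> = (\<lambda>z. \<alpha> z + \<psi> z *s v)"
  have v: "\<phi> v = 1"
    using \<phi> by (simp add: v_def \<phi>_diff)
  have \<phi>0': "\<phi> 0 = 0"
    using module_hom.zero[OF \<phi>(1)] .
  have v0: "v \<noteq> 0"
    using v \<phi>0' by auto
  have \<beta>End: "\<beta> \<in> End"
    using \<phi>(1) by (simp add: \<beta>_def End_iff functional_iff algebra_simps)
  have \<gamma>End: "\<gamma> \<in> End"
    using \<psi>(1) \<alpha> by (simp add: \<gamma>_def End_iff functional_iff algebra_simps)
  have \<beta>v: "\<beta> v = 0" and \<gamma>k: "\<gamma> k = 0" and \<gamma>x: "\<gamma> x = x"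
    using v k \<psi> by (simp_all add: \<beta>_def \<gamma>_def v_def)
  \<comment> \<open>Since \<phi> kills the range of \<alpha> and \<open>\<phi> v = 1\<close>, the
    map \<beta> removes exactly the summand \<open>\<psi> z *s v\<close> that \<gamma> adds.\<close>
  have comp: "\<alpha> = \<beta> \<circ> \<gamma>"
    using \<phi> v by (auto simp: \<beta>_def \<gamma>_def functional_iff fun_eq_iff)
  have \<phi>\<beta>: "\<phi> (\<beta> z) = 0" for z
    using \<phi>(1) v by (simp add: \<beta>_def \<phi>_diff functional_iff)
  have \<beta>fix: "\<beta> z = z" if "\<phi> z = 0" for z
    using that by (simp add: \<beta>_def)
  have "coprimitive_idempotent End \<beta>"
  proof (rule coprimitive_idempotentI[OF \<beta>End _ \<beta>v v0])
    show "\<beta> \<circ> \<beta> = \<beta>"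
      using \<phi>\<beta> \<beta>fix by auto
    show "\<exists>c d. c \<noteq> 0 \<and> c *s z = d *s v" if "\<beta> z = 0" for z
      using that by (intro exI[of _ 1] exI[of _ "\<phi> z"]) (simp add: \<beta>_def)
  qed
  moreover have "Fix \<alpha> \<subseteq> Fix \<beta>"
  proof
    fix z assume "z \<in> Fix \<alpha>"
    then show "z \<in> Fix \<beta>"
      using \<phi>(3)[of z] \<beta>fix[of z] by (simp add: Fix_def)
  qed
  moreover have "Fix \<alpha> \<subseteq> Fix \<gamma>"
    using \<psi>(4) by (auto simp: Fix_def \<gamma>_def)
  moreover have "x \<in> Fix \<gamma>" "x \<notin> Fix \<alpha>"
    using \<gamma>x \<psi>(2,4) by (auto simp: Fix_def)
  \<comment> \<open>If \<open>\<phi> k = 0\<close>, then \<beta> fixes \<open>k\<close> while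
    \<alpha> kills it. Otherwise \<open>x\<close> and \<open>k\<close> are combined into a vector
    \<open>w\<close> in the kernel of \<phi>, and \<open>\<psi> w = \<phi> k\<close> is nonzero,
    which keeps \<open>w\<close> out of \<open>Fix \<alpha>\<close>.\<close>
  moreover have "\<exists>w. w \<in> Fix \<beta> \<and> w \<notin> Fix \<alpha>"
  proof (cases "\<phi> k = 0")
    case True
    then show ?thesis
      using \<beta>fix k by (intro exI[of _ k]) (auto simp: Fix_def)
  next
    case False
    define w where "w = \<phi> k *s x - k"
    have "\<phi> w = 0"
      using \<phi> by (simp add: w_def \<phi>_diff functional_iff)
    moreover have "\<psi> w \<noteq> 0"
      using \<psi> False by (simp add: w_def module_hom.diff[OF \<psi>(1)] functional_iff)
    ultimately show ?thesis
      using \<beta>fix \<psi>(4) by (intro exI[of _ w]) (auto simp: Fix_def)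
  qed
  moreover have "\<beta> \<in> sharp End" "\<gamma> \<in> sharp End"
    using singular_in_sharp \<beta>End \<gamma>End \<beta>v v0 \<gamma>k k(2) by blast+
  moreover have "\<beta> \<noteq> id" "\<gamma> \<noteq> id"
    using \<beta>v v0 \<gamma>k k(2) by auto
  ultimately show ?thesis
    using comp \<beta>End \<gamma>End by (intro exI[of _ \<beta>] exI[of _ \<gamma>]) blast
qed

text \<open>By \<open>none\<close>, each \<open>x\<close> satisfies
  \<open>c *s x = f + d *s k\<close> with \<open>c\<close> nonzero and \<open>f\<close> fixed, and
  applying \<alpha> gives \<open>c *s \<alpha> x = f\<close>. So \<alpha> fixes
  \<open>c *s \<alpha> x\<close>, and cancelling \<open>c\<close> gives idempotence. If
  \<open>\<alpha> x = 0\<close>, then \<open>f = 0\<close>, which leaves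
  \<open>c *s x = d *s k\<close>.\<close>

lemma coprimitive_idempotent_if_no_functional:
  assumes \<alpha>: "\<alpha> \<in> End" and k: "\<alpha> k = 0" "k \<noteq> 0"
    and none: "\<And>\<psi> y. functional \<psi> \<Longrightarrow> \<psi> k = 0 \<Longrightarrow> (\<forall>x\<in>Fix \<alpha>. \<psi> x = 0) \<Longrightarrow> \<psi> y = 0"
  shows "coprimitive_idempotent End \<alpha>"
proof -
  have "subspace (Fix \<alpha>)"
    using \<alpha> by (auto simp: subspace_def Fix_def End_iff End_zero)
  have decomp: "\<exists>c d f. c \<noteq> 0 \<and> \<alpha> f = f \<and> c *s x = f + d *s k" for x
  proof -
    obtain c where "c \<noteq> 0" "c *s x \<in> span (insert k (Fix \<alpha>))"
      using torsion_quotient_if_no_functional[of "insert k (Fix \<alpha>)" x] none by auto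
    then obtain d where "c *s x - d *s k \<in> Fix \<alpha>"
      using \<open>subspace (Fix \<alpha>)\<close> by (metis span_breakdown_eq span_eq_iff)
    then show ?thesis
      using \<open>c \<noteq> 0\<close>
      by (intro exI[of _ c] exI[of _ d] exI[of _ "c *s x - d *s k"]) (auto simp: Fix_def)
  qed
  have scaled: "c *s \<alpha> x = f" if "\<alpha> f = f" "c *s x = f + d *s k" for c d f x
  proof -
    have "c *s \<alpha> x = \<alpha> (c *s x)"
      using \<alpha> by (simp add: End_iff)
    then show ?thesis
      using that k \<alpha> by (simp add: End_iff)
  qed
  show ?thesis
  proof (rule coprimitive_idempotentI[OF \<alpha> _ k])
    show "\<alpha> \<circ> \<alpha> = \<alpha>"
    proof
      fix x
      obtain c d f where cdf: "c \<noteq> 0" "\<alpha> f = f" "c *s x = f + d *s k"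
        using decomp by blast
      have eq: "c *s \<alpha> x = f"
        using scaled cdf by blast
      have "c *s \<alpha> (\<alpha> x) = c *s \<alpha> x"
      proof -
        have "c *s \<alpha> (\<alpha> x) = \<alpha> (c *s \<alpha> x)"
          using \<alpha> by (simp add: End_iff)
        then show ?thesis
          using eq cdf(2) by simp
      qed
      then have "c *s (\<alpha> (\<alpha> x) - \<alpha> x) = 0"
        by (simp add: scale_right_diff_distrib)
      then show "(\<alpha> \<circ> \<alpha>) x = \<alpha> x"
        using cdf(1) by (simp add: torsion_free)
    qed
    show "\<exists>c d. c \<noteq> 0 \<and> c *s x = d *s k" if "\<alpha> x = 0" for x
      using decomp[of x] scaled that by (metis add_0 scale_zero_right)
  qed
qed

lemma irreducible3_imp_coprimitive_idempotent:
  assumes \<alpha>: "\<alpha> \<in> End" and k: "\<alpha> k = 0" "k \<noteq> 0" and irr: "r_Fix_irreducible3 End \<alpha>"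
  shows "coprimitive_idempotent End \<alpha>"
proof (rule coprimitive_idempotent_if_no_functional[OF \<alpha> k], rule ccontr)
  fix \<psi> y
  assume \<psi>: "functional \<psi>" "\<psi> k = 0" "\<forall>x\<in>Fix \<alpha>. \<psi> x = 0" "\<psi> y \<noteq> 0"
  obtain \<beta> \<gamma> where fac: "\<beta> \<in> sharp End" "\<beta> \<noteq> id" "\<gamma> \<in> sharp End" "\<gamma> \<noteq> id" "\<alpha> = \<beta> \<circ> \<gamma>"
    "\<beta> \<in> End" "\<gamma> \<in> End" "Fix \<alpha> \<subset> Fix \<beta>" "Fix \<alpha> \<subset> Fix \<gamma>"
    using singular_factorization[OF \<alpha> k \<psi>(1,4,2)] \<psi>(3) by metis
  \<comment> \<open>The preorder reverses inclusion of fixed point sets, so the strictly larger sets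
    put both factors strictly below \<alpha>.\<close>
  have "r_Fix_less End \<beta> \<alpha>" "r_Fix_less End \<gamma> \<alpha>"
    using fac \<alpha> by (auto simp: r_Fix_less_def r_Fix_le_iff)
  then have "\<exists>bs. length bs = 2 \<and> set bs \<subseteq> r_Fix_non_units End \<and>
      (\<forall>b\<in>set bs. r_Fix_less End b \<alpha>) \<and> \<alpha> = foldr (\<circ>) bs id"
    using fac by (intro exI[of _ "[\<beta>, \<gamma>]"]) (simp add: r_Fix_non_units_def)
  then show False
    using irr unfolding r_Fix_irreducible3_def by blast
qed

end

theorem proposition5p18:
  fixes scale :: "'d::discrete_valuation_domain \<Rightarrow> 'm::ab_group_add \<Rightarrow> 'm"
    and R :: "('m \<Rightarrow> 'm) set"
    and \<alpha> :: "'m \<Rightarrow> 'm"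
    and n :: nat
  assumes "module scale"
    and "module.free_of_rank scale UNIV n"
    and "n \<ge> 2"
    and "R = module.End scale"
    and "\<alpha> \<in> R"
    and "\<not> inj \<alpha>"
  shows
    "(module.free_of_rank scale {x. \<alpha> x = 0} 1 \<and> Fix \<alpha> = {0} \<longrightarrow>
       (\<exists>\<beta> \<gamma>. \<beta> \<in> sharp R \<and> \<beta> \<noteq> id \<and> \<gamma> \<in> sharp R \<and> \<gamma> \<noteq> id \<and> \<alpha> = \<beta> \<circ> \<gamma> \<and>
          coprimitive_idempotent R \<beta> \<and> Fix \<gamma> \<noteq> {0}))
     \<and> (r_Fix_irreducible3 R \<alpha> \<longrightarrow> coprimitive_idempotent R \<alpha>)"
proof -
  interpret module scale by fact
  obtain B where B: "finite B" "card B = n" "independent B" "span B = UNIV"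
    using assms(2) by (auto simp: free_of_rank_def)
  interpret finite_free_dvd_module scale B
    using B by unfold_locales
  note R = assms(4)
  have \<alpha>: "\<alpha> \<in> End"
    using assms by simp
  then have "module_hom scale scale \<alpha>"
    by (simp add: End_def)
  then obtain k where k: "\<alpha> k = 0" "k \<noteq> 0"
    using assms(6) module_hom.inj_iff_eq_0 by blast
  have "\<exists>\<beta> \<gamma>. \<beta> \<in> sharp End \<and> \<beta> \<noteq> id \<and> \<gamma> \<in> sharp End \<and> \<gamma> \<noteq> id \<and> \<alpha> = \<beta> \<circ> \<gamma> \<and>
      coprimitive_idempotent End \<beta> \<and> Fix \<gamma> \<noteq> {0}" if Fix0: "Fix \<alpha> = {0}"
  proof -
    \<comment> \<open>A single condition, at \<open>k\<close>, faces at least two basis vectors.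
      Vanishing on \<open>Fix \<alpha>\<close> is then automatic, as this set is
      \<open>{0}\<close>.\<close>
    obtain \<psi> y where \<psi>: "functional \<psi>" "\<psi> y \<noteq> 0" "\<psi> k = 0"
      using exists_functional_killing[of "{k}"] B(2) assms(3) by auto
    have "\<psi> x = 0" if "x \<in> Fix \<alpha>" for x
      using that Fix0 module_hom.zero[OF \<psi>(1)] by simp
    then show ?thesis
      using singular_factorization[OF \<alpha> k \<psi>] Fix0 by (metis psubset_eq)
  qed
  then show ?thesis
    using irreducible3_imp_coprimitive_idempotent[OF \<alpha> k] unfolding R by blast
qed

end
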